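(* Let $-\infty<L<R<\infty$ and let $p:\mathbb{R}\to[0,\infty)$ be a probability density function with support $[L,R]$ and distribution function $P$, satisfying the following conditions. (i) $p$ is continuous and positive on $(L,R)$, and there are finitely many points $L<y_1<\dots<y_m<R$ ($m\ge 0$) such that $p$ is continuously differentiable on each component interval of $S(p)=(L,R)\setminus\{y_1,\dots,y_m\}$. (ii) $\sup_{x\in S(p)}\left|\frac{p'(x)\min\{P(x),1-P(x)\}}{p^2(x)}\right|<\infty$. (iii) $\int_{S(p)}(1+|x|)\,|p'(x)|\,\mathrm{d}x<\infty$. (iv) $\lim_{x\searrow L}\frac{P(x)}{p(x)}=0$. (v) $\lim_{x\nearrow R}\frac{1-P(x)}{p(x)}=0$. Assume that the limit $\lim_{x\searrow L}p(x)$ exists. Let $X:\Omega\to(L,R)$ be a random variable that has a Lebesgue density, with $\mathbb{E}\left|\frac{p'(X)}{p(X)}\right|<\infty$. Then $X$ has Lebesgue density $p$ if, and only if, the density function $\mathfrak{f}_X$ of $X$ (for a suitable version) satisfies $$\mathfrak{f}_X(t)=\mathbb{E}\left[\frac{p'(X)}{p(X)}\,\mathbf{1}\{X\le t\}\right]+\lim_{x\searrow L}p(x),\quad L<t<R.$$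
   Context: $(\Omega,\mathcal{A},\mathbb{P})$ is a probability space and $\mathbf{1}\{\cdot\}$ denotes an indicator. "$X$ has Lebesgue density $p$" means that the law of $X$ is $p\,\mathcal{L}^1$, where $\mathcal{L}^1$ is Lebesgue measure on $\mathbb{R}$. $P(x)=\int_{L}^x p(s)\,\mathrm{d}s$ for $x\in[L,R]$. The case $m=0$ is allowed. "The limit exists" means that it exists as a (finite) real number. Densities are unique only up to $\mathcal{L}^1$-null sets; "for a suitable version" means that the function on the right-hand side is (on $(L,R)$) a density function of $X$. *)

theory Defs
  imports "HOL-Probability.Probability"
begin

definition prob_density_fun :: "(real \<Rightarrow> real) \<Rightarrow> bool" where
  "prob_density_fun f \<longleftrightarrow>
     f \<in> borel_measurable borel \<and> (\<forall>x. 0 \<le> f x) \<and> has_bochner_integral lborel f 1"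

text \<open>The law of \<open>X\<close> is \<open>f\<close> times Lebesgue measure. Requiring \<open>0 \<le> f\<close> everywhere keeps
  \<open>ennreal\<close>, which sends negative numbers to \<open>0\<close>, from altering \<open>f\<close>.\<close>

definition has_lebesgue_density :: "'a measure \<Rightarrow> ('a \<Rightarrow> real) \<Rightarrow> (real \<Rightarrow> real) \<Rightarrow> bool" where
  "has_lebesgue_density M X f \<longleftrightarrow>
     (\<forall>x. 0 \<le> f x) \<and> distributed M lborel X (\<lambda>x. ennreal (f x))"

definition dist_fun :: "real \<Rightarrow> (real \<Rightarrow> real) \<Rightarrow> real \<Rightarrow> real" where
  "dist_fun L p x = (LBINT s:{L..x}. p s)"

end

theory Submission
  imports Defs
begin

text \<open>On \<open>(L, R)\<close> put \<open>h = p' / p\<close>. For any density \<open>f\<close> of \<open>X\<close> the expectation in the theorem is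
  the indefinite integral of \<open>f h\<close> from \<open>L\<close> to \<open>t\<close>, so the asserted identity is the integral form
  of the linear differential equation \<open>f' = (p' / p) f\<close> with initial value \<open>p(L+)\<close>.

  The density \<open>p\<close> solves it by the fundamental theorem of calculus: since \<open>p h = p'\<close>,
  the difference of \<open>p\<close> and the indefinite integral of \<open>p h\<close> is continuous with zero derivative off
  finitely many points, hence constant, and letting \<open>t\<close> tend to \<open>L\<close> gives the constant
  (\<open>integral_equation_of_primitive\<close>).

  Conversely, if a density \<open>f\<close> solves it, then \<open>f / p\<close> is continuous with zero derivative off the
  exceptional points, so \<open>f = k p\<close> on \<open>(L, R)\<close> (\<open>proportional_if_log_derivative_equation\<close>). Both
  functions have total mass one and vanish almost everywhere outside \<open>(L, R)\<close>, so \<open>k = 1\<close>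
  (\<open>proportional_densities_AE_eq\<close>), and \<open>p\<close> is a density of \<open>X\<close> as well.\<close>

section \<open>Piecewise differentiable functions and indefinite integrals\<close>

text \<open>Components of an open subset of the line are open, so continuity of the derivative relative to
  a component is continuity at each of its points.\<close>

lemma C1_on_components_deriv:
  fixes f :: "real \<Rightarrow> real"
  assumes "open S" and C1: "\<forall>C\<in>components S. f C1_differentiable_on C" and "x \<in> S"
  shows "(f has_real_derivative deriv f x) (at x)" and "isCont (deriv f) x"
proof -
  obtain C where C: "C \<in> components S" "x \<in> C"
    using \<open>x \<in> S\<close> by (metis Union_components UnionE)
  with \<open>open S\<close> have "open C"
    by (blast intro: open_components)
  from C1 C(1) obtain D where
    D: "\<And>y. y \<in> C \<Longrightarrow> (f has_real_derivative D y) (at y)" and cont: "continuous_on C D"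
    unfolding C1_differentiable_on_def has_real_derivative_iff_has_vector_derivative by blast
  have eq: "D y = deriv f y" if "y \<in> C" for y
    using D[OF that] by (simp add: DERIV_imp_deriv)
  show "(f has_real_derivative deriv f x) (at x)"
    using D C(2) eq by metis
  have "continuous_on C (deriv f)"
    using cont eq by (simp cong: continuous_on_cong)
  then show "isCont (deriv f) x"
    using \<open>open C\<close> C(2) continuous_on_eq_continuous_at by blast
qed

lemma indefinite_integral_DERIV:
  fixes g :: "real \<Rightarrow> real"
  assumes "g integrable_on {a..b}" and x: "a < x" "x < b" and "isCont g x"
  shows "((\<lambda>t. integral {a..t} g) has_real_derivative g x) (at x)"
proof -
  have "((\<lambda>t. integral {a..t} g) has_vector_derivative g x) (at x within {a..b} - {})"
    using assms by (intro integral_has_vector_derivative_continuous_at)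
      (auto intro: continuous_at_imp_continuous_at_within)
  moreover have "at x within {a..b} = at x"
    using x by (intro at_within_interior) simp
  ultimately show ?thesis
    by (simp add: has_real_derivative_iff_has_vector_derivative)
qed

text \<open>The value \<open>p a\<close> is a matter of convention for a density, so the initial value of this form of
  the fundamental theorem of calculus is the one-sided limit \<open>l\<close>: the integral tends to \<open>0\<close> at \<open>a\<close>,
  so \<open>l\<close> is the constant value of \<open>p\<close> minus the integral.\<close>

lemma integral_equation_of_primitive:
  fixes p g :: "real \<Rightarrow> real"
  assumes "finite Y" and g: "g integrable_on {a..b}"
    and cont: "continuous_on {a<..<b} p"
    and deriv: "\<And>x. x \<in> {a<..<b} - Y \<Longrightarrow> (p has_real_derivative g x) (at x)"
    and gcont: "\<And>x. x \<in> {a<..<b} - Y \<Longrightarrow> isCont g x"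
    and lim: "(p \<longlongrightarrow> l) (at_right a)" and t: "t \<in> {a<..<b}"
  shows "p t = integral {a..t} g + l"
proof -
  define G where "G = (\<lambda>t. integral {a..t} g)"
  have Gcont: "continuous_on {a..b} G"
    unfolding G_def by (rule indefinite_integral_continuous_1[OF g])
  have "(\<lambda>x. p x - G x) constant_on {a<..<b}"
  proof (rule DERIV_zero_connected_constant_on[OF _ _ \<open>finite Y\<close>])
    show "continuous_on {a<..<b} (\<lambda>x. p x - G x)"
      by (intro continuous_intros cont continuous_on_subset[OF Gcont]) auto
    show "\<forall>x\<in>{a<..<b} - Y. ((\<lambda>x. p x - G x) has_real_derivative 0) (at x)"
    proof
      fix x assume x: "x \<in> {a<..<b} - Y"
      have "(G has_real_derivative g x) (at x)"
        unfolding G_def using x by (intro indefinite_integral_DERIV[OF g] gcont) auto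
      from DERIV_diff[OF deriv[OF x] this]
      show "((\<lambda>x. p x - G x) has_real_derivative 0) (at x)" by simp
    qed
  qed auto
  then have diff_const: "p x - G x = p t - G t" if "x \<in> {a<..<b}" for x
    using that t unfolding constant_on_def by metis
  have "a < b" using t by simp
  have "(G \<longlongrightarrow> G a) (at_right a)"
    using Gcont \<open>a < b\<close> by (simp add: continuous_on_Icc_at_rightD)
  then have "((\<lambda>x. p x - G x) \<longlongrightarrow> l) (at_right a)"
    using tendsto_diff[OF lim] by (fastforce simp: G_def)
  moreover have "((\<lambda>x. p x - G x) \<longlongrightarrow> p t - G t) (at_right a)"
  proof (rule tendsto_eventually)
    show "\<forall>\<^sub>F x in at_right a. p x - G x = p t - G t"
      using eventually_at_right_real[OF \<open>a < b\<close>] by eventually_elim (rule diff_const)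
  qed
  ultimately have "l = p t - G t"
    by (intro tendsto_unique[of "at_right a"]) auto
  then show ?thesis by (simp add: G_def)
qed

text \<open>The integral equation makes \<open>f\<close> continuous on the whole interval, so \<open>h f\<close> is continuous off
  \<open>Y\<close> and \<open>f\<close> is differentiable there; the quotient rule then cancels the derivative of
  \<open>f / p\<close>.\<close>

lemma proportional_if_log_derivative_equation:
  fixes f p h :: "real \<Rightarrow> real"
  assumes "finite Y" and fh: "(\<lambda>s. f s * h s) integrable_on {a..b}"
    and cont: "continuous_on {a<..<b} p" and pos: "\<And>x. x \<in> {a<..<b} \<Longrightarrow> 0 < p x"
    and deriv: "\<And>x. x \<in> {a<..<b} - Y \<Longrightarrow> (p has_real_derivative p x * h x) (at x)"
    and hcont: "\<And>x. x \<in> {a<..<b} - Y \<Longrightarrow> isCont h x"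
    and eq: "\<And>t. t \<in> {a<..<b} \<Longrightarrow> f t = integral {a..t} (\<lambda>s. f s * h s) + c"
  obtains k where "\<And>x. x \<in> {a<..<b} \<Longrightarrow> f x = k * p x"
proof -
  have fcont: "continuous_on {a<..<b} f"
  proof -
    have "continuous_on {a<..<b} (\<lambda>t. integral {a..t} (\<lambda>s. f s * h s) + c)"
      by (intro continuous_intros continuous_on_subset[OF indefinite_integral_continuous_1[OF fh]])
        auto
    then show ?thesis by (subst continuous_on_cong[OF refl eq])
  qed
  have fderiv: "(f has_real_derivative f x * h x) (at x)" if x: "x \<in> {a<..<b} - Y" for x
  proof -
    have "isCont f x"
      using fcont x by (simp add: continuous_on_eq_continuous_at)
    then have "isCont (\<lambda>s. f s * h s) x"
      by (intro continuous_intros hcont x)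
    then have "((\<lambda>t. integral {a..t} (\<lambda>s. f s * h s) + c) has_real_derivative f x * h x) (at x)"
      using x indefinite_integral_DERIV[OF fh, of x] by (auto intro!: derivative_eq_intros)
    then show ?thesis
      by (rule has_field_derivative_transform_within_open[of _ _ _ "{a<..<b}"]) (use x eq in auto)
  qed
  have quot_deriv: "\<forall>x\<in>{a<..<b} - Y. ((\<lambda>x. f x / p x) has_real_derivative 0) (at x)"
  proof
    fix x assume x: "x \<in> {a<..<b} - Y"
    then have "p x \<noteq> 0" using pos[of x] by auto
    from DERIV_divide[OF fderiv[OF x] deriv[OF x] this]
    show "((\<lambda>x. f x / p x) has_real_derivative 0) (at x)"
      by (simp add: mult_ac)
  qed
  have "continuous_on {a<..<b} (\<lambda>x. f x / p x)"
    using pos by (intro continuous_intros fcont cont) (auto simp: less_imp_neq[symmetric])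
  then have "(\<lambda>x. f x / p x) constant_on {a<..<b}"
    using quot_deriv \<open>finite Y\<close> by (intro DERIV_zero_connected_constant_on) auto
  then obtain k where "\<And>x. x \<in> {a<..<b} \<Longrightarrow> f x / p x = k"
    unfolding constant_on_def by blast
  with pos that show thesis
    by (metis less_irrefl nonzero_divide_eq_eq)
qed

section \<open>Expectations and densities\<close>

text \<open>As \<open>h\<close> vanishes up to \<open>a\<close>, the integral over \<open>(-\<infinity>, t]\<close> starts at \<open>a\<close>. It is a
  Henstock-Kurzweil integral here because the results on indefinite integrals are about that
  integral.\<close>

lemma distributed_integral_atMost:
  fixes f h :: "real \<Rightarrow> real"
  assumes X: "distributed M lborel X (\<lambda>x. ennreal (f x))" and nonneg: "\<And>x. 0 \<le> f x"
    and h: "h \<in> borel_measurable borel" and int: "integrable M (\<lambda>\<omega>. h (X \<omega>))"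
    and zero: "\<And>s. s \<le> a \<Longrightarrow> h s = 0"
  shows "(\<lambda>s. f s * h s) integrable_on {a..t}"
    and "(\<integral>\<omega>. h (X \<omega>) * indicator {..t} (X \<omega>) \<partial>M) = integral {a..t} (\<lambda>s. f s * h s)"
proof -
  have "integrable lborel (\<lambda>s. f s * h s)"
    using distributed_integrable[OF X, of h] nonneg h int by simp
  then have *: "set_integrable lborel {a..t} (\<lambda>s. f s * h s)"
    unfolding set_integrable_def by (intro integrable_mult_indicator) auto
  show "(\<lambda>s. f s * h s) integrable_on {a..t}"
    by (rule set_borel_integral_eq_integral(1)[OF *])
  have "(\<integral>\<omega>. h (X \<omega>) * indicator {..t} (X \<omega>) \<partial>M)
      = (\<integral>s. f s * (h s * indicator {..t} s) \<partial>lborel)"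
    using distributed_integral[OF X, of "\<lambda>s. h s * indicator {..t} s"] nonneg h by simp
  also have "\<dots> = (LINT s:{a..t}|lborel. f s * h s)"
    unfolding set_lebesgue_integral_def
    by (intro Bochner_Integration.integral_cong) (auto simp: indicator_def zero)
  also have "\<dots> = integral {a..t} (\<lambda>s. f s * h s)"
    by (rule set_borel_integral_eq_integral(2)[OF *])
  finally show "(\<integral>\<omega>. h (X \<omega>) * indicator {..t} (X \<omega>) \<partial>M) = integral {a..t} (\<lambda>s. f s * h s)" .
qed

lemma proportional_densities_AE_eq:
  fixes f p :: "'b \<Rightarrow> real"
  assumes f: "has_bochner_integral N f 1" and p: "has_bochner_integral N p 1"
    and proportional: "AE x in N. f x = k * p x"
  shows "AE x in N. f x = p x"
proof -
  have "(\<integral>x. f x \<partial>N) = (\<integral>x. k * p x \<partial>N)"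
    using f p proportional by (intro integral_cong_AE) (auto simp: has_bochner_integral_iff)
  then have "k = 1"
    using f p by (simp add: has_bochner_integral_iff)
  with proportional show ?thesis by simp
qed

section \<open>Characterization of the density by an integral equation\<close>

theorem lemma6p4:
  fixes L R :: real and p P :: "real \<Rightarrow> real" and Y S :: "real set"
    and M :: "'a measure" and X :: "'a \<Rightarrow> real"
  defines "P \<equiv> dist_fun L p"
    and "S \<equiv> {L<..<R} - Y"
  assumes LR: "L < R"
    and dens: "prob_density_fun p"
    and supp: "closure {x. p x \<noteq> 0} = {L..R}"
    and i_cont: "continuous_on {L<..<R} p"
    and i_pos: "\<forall>x\<in>{L<..<R}. 0 < p x"
    and i_points: "finite Y" "Y \<subseteq> {L<..<R}"
    and i_C1: "\<forall>C\<in>components S. p C1_differentiable_on C"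
    and ii: "bdd_above ((\<lambda>x. \<bar>deriv p x * min (P x) (1 - P x) / (p x)\<^sup>2\<bar>) ` S)"
    and iii: "set_integrable lborel S (\<lambda>x. (1 + \<bar>x\<bar>) * \<bar>deriv p x\<bar>)"
    and iv: "((\<lambda>x. P x / p x) \<longlongrightarrow> 0) (at_right L)"
    and v: "((\<lambda>x. (1 - P x) / p x) \<longlongrightarrow> 0) (at_left R)"
    and lim: "\<exists>l. (p \<longlongrightarrow> l) (at_right L)"
    and prob: "prob_space M"
    and X_meas: "X \<in> borel_measurable M"
    and X_range: "\<forall>\<omega>\<in>space M. X \<omega> \<in> {L<..<R}"
    and X_dens: "\<exists>f. has_lebesgue_density M X f"
    and X_int: "integrable M (\<lambda>\<omega>. \<bar>deriv p (X \<omega>) / p (X \<omega>)\<bar>)"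
  shows "has_lebesgue_density M X p \<longleftrightarrow>
    (\<exists>f. has_lebesgue_density M X f \<and>
      (\<forall>t. L < t \<and> t < R \<longrightarrow>
        f t = (\<integral>\<omega>. deriv p (X \<omega>) / p (X \<omega>) * indicator {\<omega>. X \<omega> \<le> t} \<omega> \<partial>M)
              + Lim (at_right L) p))"
proof -
  interpret prob_space M by (rule prob)
  define c where "c = Lim (at_right L) p"
  \<comment> \<open>Cutting off outside \<open>(L, R)\<close> changes nothing along \<open>X\<close>, but it lets the integrals of \<open>f h\<close>
    start at \<open>L\<close> and makes \<open>h\<close> a Borel function: it is continuous on \<open>S\<close> and, apart from the finite
    set \<open>Y\<close>, zero elsewhere.\<close>
  define h where "h = (\<lambda>x. indicator {L<..<R} x * (deriv p x / p x))"
  have p_meas: "p \<in> borel_measurable borel" and p_nonneg: "\<And>x. 0 \<le> p x"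
    and p_one: "has_bochner_integral lborel p 1"
    using dens by (auto simp: prob_density_fun_def)
  have p_lim: "(p \<longlongrightarrow> c) (at_right L)"
    using lim unfolding c_def by (metis tendsto_Lim trivial_limit_at_right_real)
  have "open S"
    unfolding S_def using i_points by (intro open_Diff finite_imp_closed) auto
  have p_deriv: "(p has_real_derivative deriv p x) (at x)" and deriv_cont: "isCont (deriv p) x"
    if "x \<in> S" for x
    using C1_on_components_deriv[OF \<open>open S\<close> i_C1 that] by auto
  have h_cont: "isCont h x" if x: "x \<in> S" for x
  proof -
    have x': "x \<in> {L<..<R}" using x by (simp add: S_def)
    have "isCont (\<lambda>x. deriv p x / p x) x"
      using deriv_cont[OF x] DERIV_isCont[OF p_deriv[OF x]] i_pos x' by fastforce
    moreover have "\<forall>\<^sub>F y in nhds x. h y = deriv p y / p y"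
      using eventually_nhds_in_open[OF open_greaterThanLessThan x']
      by eventually_elim (simp add: h_def)
    ultimately show ?thesis by (simp cong: isCont_cong)
  qed
  have ph: "p x * h x = deriv p x" if "x \<in> {L<..<R}" for x
    using i_pos that by (force simp: h_def)
  have h_meas: "h \<in> borel_measurable borel"
  proof (rule measurable_discrete_difference)
    have "S \<in> sets borel" using \<open>open S\<close> by simp
    moreover have "continuous_on S h"
      using h_cont by (simp add: continuous_at_imp_continuous_on)
    ultimately show "(\<lambda>x. indicator S x *\<^sub>R h x) \<in> borel_measurable borel"
      by (rule borel_measurable_continuous_on_indicator)
    show "countable Y" using i_points by (simp add: countable_finite)
    show "indicator S x *\<^sub>R h x = h x" if "x \<notin> Y" for x
      using that by (auto simp: S_def h_def indicator_def)
  qed auto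
  have hX: "h (X \<omega>) = deriv p (X \<omega>) / p (X \<omega>)" if "\<omega> \<in> space M" for \<omega>
    using X_range that by (simp add: h_def)
  have hX_int: "integrable M (\<lambda>\<omega>. h (X \<omega>))"
  proof (rule integrable_norm_cancel)
    show "integrable M (\<lambda>\<omega>. norm (h (X \<omega>)))"
      using X_int by (simp add: hX cong: Bochner_Integration.integrable_cong)
    show "(\<lambda>\<omega>. h (X \<omega>)) \<in> borel_measurable M"
      using h_meas X_meas by simp
  qed
  have h_zero: "h s = 0" if "s \<le> L" for s
    using that by (simp add: h_def)
  \<comment> \<open>This holds for every density of \<open>X\<close>: one direction of the theorem uses it with \<open>p\<close>, the other
    with the solution of the integral equation.\<close>
  have E_eq: "(\<integral>\<omega>. deriv p (X \<omega>) / p (X \<omega>) * indicator {\<omega>. X \<omega> \<le> t} \<omega> \<partial>M)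
      = integral {L..t} (\<lambda>s. f s * h s)"
    and fh_int: "(\<lambda>s. f s * h s) integrable_on {L..t}"
    if "has_lebesgue_density M X f" for f t
  proof -
    have f: "distributed M lborel X (\<lambda>x. ennreal (f x))" "\<And>x. 0 \<le> f x"
      using that by (auto simp: has_lebesgue_density_def)
    have "(\<integral>\<omega>. deriv p (X \<omega>) / p (X \<omega>) * indicator {\<omega>. X \<omega> \<le> t} \<omega> \<partial>M)
        = (\<integral>\<omega>. h (X \<omega>) * indicator {..t} (X \<omega>) \<partial>M)"
      by (intro Bochner_Integration.integral_cong) (auto simp: hX indicator_def)
    then show "(\<integral>\<omega>. deriv p (X \<omega>) / p (X \<omega>) * indicator {\<omega>. X \<omega> \<le> t} \<omega> \<partial>M)
        = integral {L..t} (\<lambda>s. f s * h s)"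
      using distributed_integral_atMost(2)[OF f h_meas hX_int h_zero] by simp
    show "(\<lambda>s. f s * h s) integrable_on {L..t}"
      by (rule distributed_integral_atMost(1)[OF f h_meas hX_int h_zero])
  qed
  show ?thesis
  proof
    assume X_p: "has_lebesgue_density M X p"
    have "p t = integral {L..t} (\<lambda>s. p s * h s) + c" if "t \<in> {L<..<R}" for t
    proof (rule integral_equation_of_primitive[OF _ fh_int[OF X_p] i_cont _ _ p_lim that])
      fix x assume "x \<in> {L<..<R} - Y"
      then have x: "x \<in> S" "x \<in> {L<..<R}" by (auto simp: S_def)
      show "(p has_real_derivative p x * h x) (at x)"
        using p_deriv[OF x(1)] ph[OF x(2)] by simp
      show "isCont (\<lambda>s. p s * h s) x"
        using DERIV_isCont[OF p_deriv[OF x(1)]] h_cont[OF x(1)] by (intro continuous_intros)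
    qed (use i_points in simp)
    then show "\<exists>f. has_lebesgue_density M X f \<and> (\<forall>t. L < t \<and> t < R \<longrightarrow>
        f t = (\<integral>\<omega>. deriv p (X \<omega>) / p (X \<omega>) * indicator {\<omega>. X \<omega> \<le> t} \<omega> \<partial>M)
              + Lim (at_right L) p)"
      using X_p unfolding E_eq[OF X_p] c_def[symmetric] by (intro exI[of _ p]) auto
  next
    assume "\<exists>f. has_lebesgue_density M X f \<and> (\<forall>t. L < t \<and> t < R \<longrightarrow>
        f t = (\<integral>\<omega>. deriv p (X \<omega>) / p (X \<omega>) * indicator {\<omega>. X \<omega> \<le> t} \<omega> \<partial>M)
              + Lim (at_right L) p)"
    then obtain f where X_f: "has_lebesgue_density M X f" and
      f_eq: "\<And>t. t \<in> {L<..<R} \<Longrightarrow>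
        f t = (\<integral>\<omega>. deriv p (X \<omega>) / p (X \<omega>) * indicator {\<omega>. X \<omega> \<le> t} \<omega> \<partial>M)
              + Lim (at_right L) p"
      by auto
    have f: "distributed M lborel X (\<lambda>x. ennreal (f x))" and f_nonneg: "\<And>x. 0 \<le> f x"
      using X_f by (auto simp: has_lebesgue_density_def)
    obtain k where k: "\<And>x. x \<in> {L<..<R} \<Longrightarrow> f x = k * p x"
    proof (rule proportional_if_log_derivative_equation[OF _ fh_int[OF X_f] i_cont])
      fix x assume "x \<in> {L<..<R} - Y"
      then have x: "x \<in> S" "x \<in> {L<..<R}" by (auto simp: S_def)
      show "(p has_real_derivative p x * h x) (at x)"
        using p_deriv[OF x(1)] ph[OF x(2)] by simp
      show "isCont h x" by (rule h_cont[OF x(1)])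
    next
      show "f t = integral {L..t} (\<lambda>s. f s * h s) + c" if "t \<in> {L<..<R}" for t
        using f_eq[OF that] unfolding E_eq[OF X_f] c_def .
    qed (use i_points i_pos in auto)
    have p_zero: "p x = 0" if "x \<notin> {L..R}" for x
      using that supp closure_subset[of "{x. p x \<noteq> 0}"] by auto
    \<comment> \<open>Proportionality on \<open>(L, R)\<close> extends to almost every real number: outside \<open>[L, R]\<close> both
      functions vanish almost everywhere, and the two end points are a null set.\<close>
    have "AE x in lborel. 0 < ennreal (f x) \<longrightarrow> x \<in> {L<..<R}"
    proof -
      have "AE \<omega> in M. X \<omega> \<in> {L<..<R}" using X_range by (intro AE_I2) auto
      then show ?thesis by (subst (asm) distributed_AE2[OF f]) auto
    qed
    moreover have "AE x in lborel. x \<noteq> L" "AE x in lborel. x \<noteq> R"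
      by (rule AE_lborel_singleton)+
    ultimately have f_prop: "AE x in lborel. f x = k * p x"
    proof eventually_elim
      case (elim x)
      show ?case
      proof (cases "x \<in> {L<..<R}")
        case False
        with elim have "f x = 0" using f_nonneg[of x] by (auto simp: less_le)
        moreover have "p x = 0" using False elim p_zero by force
        ultimately show ?thesis by simp
      qed (rule k)
    qed
    have f_one: "has_bochner_integral lborel f 1"
    proof -
      have "integrable lborel f"
        using distributed_integrable[OF f, of "\<lambda>_. 1"] f_nonneg by simp
      moreover have "(\<integral>x. f x \<partial>lborel) = 1"
        using distributed_integral[OF f, of "\<lambda>_. 1"] f_nonneg by (simp add: prob_space)
      ultimately show ?thesis by (simp add: has_bochner_integral_iff)
    qed
    have "AE x in lborel. ennreal (f x) = ennreal (p x)"
      using proportional_densities_AE_eq[OF f_one p_one f_prop] by eventually_elim simp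
    then have "distributed M lborel X (\<lambda>x. ennreal (p x))"
      using f p_meas
        distributed_cong_density[OF _ _ distributed_borel_measurable[OF f],
          of "\<lambda>x. ennreal (p x)" M X]
      by simp
    then show "has_lebesgue_density M X p"
      using p_nonneg by (simp add: has_lebesgue_density_def)
  qed
qed

end
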